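(* Let $(\mathcal{X},\varphi)$ be a Cantor minimal system, meaning that $\varphi\colon\mathcal{X}\rightarrow\mathcal{X}$ is a homeomorphism of the Cantor space $\mathcal{X}$ such that the group $\langle\varphi\rangle$ acts minimally on $\mathcal{X}$, and let $[\varphi]$ be the topological full group of this system. Then, for all $x,y\in\mathcal{X}$, there exists a homeomorphism $f\colon\mathcal{X}\rightarrow\mathcal{X}$ such that $f\,\mathrm{St}_{[\varphi]}(x)\,f^{-1}=\mathrm{St}_{[\varphi]}(y)$.
   Context: An action on $\mathcal{X}$ is minimal if the orbit of every point is dense in $\mathcal{X}$. The topological full group $[\varphi]$ is the group of all homeomorphisms $h$ of $\mathcal{X}$ such that for every $x\in\mathcal{X}$ there exist an open neighbourhood $U$ of $x$ and an element $g\in\langle\varphi\rangle$ with $h|_U=g|_U$. For a group $H$ of homeomorphisms of $\mathcal{X}$, $\mathrm{St}_H(x)=\{h\in H\mid h(x)=x\}$. *)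

theory Defs
  imports "HOL-Analysis.Analysis" "HOL-Algebra.Generated_Groups"
begin

text \<open>The space is the whole type \<^typ>\<open>'a\<close>, and it is a Cantor space when it is homeomorphic to
  \<open>{0,1}\<^sup>\<nat>\<close>; the type \<^typ>\<open>nat \<Rightarrow> bool\<close> carries the product topology over discrete
  \<^typ>\<open>bool\<close>.\<close>

definition cantor_space :: "'a::topological_space itself \<Rightarrow> bool" where
  "cantor_space _ \<longleftrightarrow> (UNIV :: 'a set) homeomorphic (UNIV :: (nat \<Rightarrow> bool) set)"

definition homeo_group :: "('a::topological_space \<Rightarrow> 'a) monoid" where
  "homeo_group = \<lparr>carrier = {h. \<exists>k. homeomorphism UNIV UNIV h k}, mult = (\<circ>), one = id\<rparr>"

lemma group_homeo_group: "group (homeo_group :: ('a::topological_space \<Rightarrow> 'a) monoid)"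
proof (rule groupI)
  fix g h :: "'a \<Rightarrow> 'a"
  assume "g \<in> carrier homeo_group" "h \<in> carrier homeo_group"
  then show "g \<otimes>\<^bsub>homeo_group\<^esub> h \<in> carrier homeo_group"
    using homeomorphism_compose by (fastforce simp: homeo_group_def)
next
  show "\<one>\<^bsub>homeo_group\<^esub> \<in> carrier (homeo_group :: ('a \<Rightarrow> 'a) monoid)"
    using homeomorphism_ident[of UNIV] by (auto simp: homeo_group_def id_def)
next
  fix h :: "'a \<Rightarrow> 'a"
  assume "h \<in> carrier homeo_group"
  then obtain k where "homeomorphism UNIV UNIV h k"
    by (auto simp: homeo_group_def)
  then show "\<exists>k\<in>carrier homeo_group. k \<otimes>\<^bsub>homeo_group\<^esub> h = \<one>\<^bsub>homeo_group\<^esub>"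
    by (intro bexI[of _ k]) (auto simp: homeo_group_def homeomorphism_def)
qed (auto simp: homeo_group_def comp_assoc)

definition minimal_action :: "('a::topological_space \<Rightarrow> 'a) set \<Rightarrow> bool" where
  "minimal_action H \<longleftrightarrow> (\<forall>x. closure {h x | h. h \<in> H} = UNIV)"

definition cantor_minimal_system :: "('a::topological_space \<Rightarrow> 'a) \<Rightarrow> bool" where
  "cantor_minimal_system \<phi> \<longleftrightarrow>
     cantor_space TYPE('a) \<and> \<phi> \<in> carrier homeo_group \<and> minimal_action (generate homeo_group {\<phi>})"

definition topological_full_group :: "('a::topological_space \<Rightarrow> 'a) \<Rightarrow> ('a \<Rightarrow> 'a) set" where
  "topological_full_group \<phi> =
     {h \<in> carrier homeo_group.
        \<forall>x. \<exists>U g. open U \<and> x \<in> U \<and> g \<in> generate homeo_group {\<phi>} \<and> (\<forall>z\<in>U. h z = g z)}"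

definition St :: "('a \<Rightarrow> 'a) set \<Rightarrow> 'a \<Rightarrow> ('a \<Rightarrow> 'a) set" where
  "St H x = {h \<in> H. h x = x}"

end

theory Submission
  imports Defs
begin

text \<open>Let \<open>\<Gamma>\<close> be the group generated by \<open>\<phi>\<close>. The conjugator \<open>f\<close> is a homeomorphism with
  \<open>f x = y\<close> that agrees locally with elements of \<open>\<Gamma>\<close> away from \<open>x\<close>. It need not lie in the full
  group, but conjugation by it still preserves being locally in \<open>\<Gamma>\<close>: since \<open>\<Gamma>\<close> acts freely, an
  element of the full group fixing \<open>x\<close> is the identity near \<open>x\<close>. The map \<open>f\<close> is the limit of
  elements \<open>g\<^sub>n\<close> of the full group, with neighbourhoods \<open>U\<^sub>n\<close> of \<open>x\<close> shrinking to \<open>x\<close> such that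
  \<open>g\<^sub>n U\<^sub>n\<close> contains \<open>y\<close> and shrinks to \<open>y\<close>, and \<open>g\<^sub>n\<^sub>+\<^sub>1 = g\<^sub>n\<close> off \<open>U\<^sub>n\<close>. To pass from \<open>n\<close> to \<open>n + 1\<close>
  compose with involutions, supported in \<open>U\<^sub>n\<close>, that swap small clopen sets and move \<open>x\<close> close to
  \<open>g\<^sub>n\<^sup>-\<^sup>1 y\<close>, and vice versa.\<close>

section \<open>Clopen neighbourhood bases in the Cantor space\<close>

text \<open>The cylinders of sequences agreeing with \<open>e x\<close> in the first
  \<open>n\<close> coordinates are clopen and shrink to \<open>e x\<close>; pulled back along
  \<open>e\<close> they give the \<open>P n\<close>. The type class carries no separation axiom, so
  separated and non-isolated points are recorded here as well.\<close>

lemma cantor_clopen_basis: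
  fixes x :: "'a::topological_space"
  assumes "cantor_space TYPE('a)"
  obtains P :: "nat \<Rightarrow> 'a set"
  where "\<forall>n. open (P n) \<and> closed (P n) \<and> x \<in> P n \<and> (\<exists>y\<in>P n. y \<noteq> x)"
    "\<forall>U. open U \<longrightarrow> x \<in> U \<longrightarrow> (\<exists>n. P n \<subseteq> U)"
    "\<forall>y. y \<noteq> x \<longrightarrow> (\<exists>n. y \<notin> P n)"
proof -
  from assms obtain e :: "'a \<Rightarrow> nat \<Rightarrow> bool" and d
    where ed: "homeomorphism UNIV UNIV e d"
    by (auto simp: cantor_space_def homeomorphic_def)
  have de: "d (e z) = z" and ed': "e (d t) = t" for z t
    using ed by (auto simp: homeomorphism_def)
  have ce: "continuous_on UNIV e" and cd: "continuous_on UNIV d"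
    using ed by (auto simp: homeomorphism_def)
  define C where "C n = {t. \<forall>i<n. t i = e x i}" for n
  define P where "P n = e -` C n" for n
  have C_Int: "C n = (\<Inter>i<n. (\<lambda>t. t i) -` {e x i})" for n
    by (auto simp: C_def)
  have coord: "continuous_on UNIV (\<lambda>t :: nat \<Rightarrow> bool. t i)" for i
    by (rule continuous_on_product_coordinates)
  have oC: "open (C n)" for n
    unfolding C_Int by (intro open_INT finite_lessThan ballI open_vimage coord open_discrete)
  have cC: "closed (C n)" for n
    unfolding C_Int
    by (intro closed_INT ballI closed_vimage coord) (simp add: closed_def open_discrete)
  have nbhd: "\<exists>n. P n \<subseteq> U" if "open U" "x \<in> U" for U
  proof -
    have "open (d -` U)" "e x \<in> d -` U"
      using that cd de by (auto intro: open_vimage)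
    then obtain X where X: "e x \<in> Pi\<^sub>E UNIV X" "finite {i. X i \<noteq> UNIV}"
        "Pi\<^sub>E UNIV X \<subseteq> d -` U"
      using product_topology_open_contains_basis[of "\<lambda>_. euclidean" UNIV "d -` U" "e x"]
      by (auto simp: open_fun_def)
    \<comment> \<open>A basic box restricts only finitely many coordinates; a cylinder reaching
      beyond all of them lies inside it.\<close>
    obtain n where n: "\<And>i. X i \<noteq> UNIV \<Longrightarrow> i < n"
      using X(2) unfolding finite_nat_set_iff_bounded by blast
    have "P n \<subseteq> U"
    proof
      fix z assume z: "z \<in> P n"
      have "e z i \<in> X i" for i
        using z X(1) n[of i] by (cases "X i = UNIV") (auto simp: P_def C_def PiE_def Pi_def)
      with X(3) have "d (e z) \<in> U" by blast
      then show "z \<in> U" by (simp add: de)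
    qed
    then show ?thesis ..
  qed
  have sep: "\<exists>n. y \<notin> P n" if "y \<noteq> x" for y
  proof -
    from that de have "e y \<noteq> e x" by metis
    then obtain i where "e y i \<noteq> e x i" by blast
    then have "y \<notin> P (Suc i)" by (auto simp: P_def C_def)
    then show ?thesis ..
  qed
  have perf: "\<exists>y\<in>P n. y \<noteq> x" for n
  proof
    \<comment> \<open>Coordinate \<open>n\<close> is the first one that \<open>C n\<close> leaves
      free, so flipping it stays in the cylinder.\<close>
    define t where "t = (e x)(n := \<not> e x n)"
    show "d t \<in> P n" by (auto simp: P_def C_def t_def ed')
    have "t \<noteq> e x" by (auto simp: t_def fun_eq_iff)
    then show "d t \<noteq> x" using ed' by metis
  qed
  have "open (P n)" "closed (P n)" for n
    using oC cC ce by (auto simp: P_def intro: open_vimage closed_vimage)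
  moreover have "x \<in> P n" for n by (simp add: P_def C_def)
  ultimately show thesis using that[of P] nbhd sep perf by simp
qed

section \<open>The homeomorphism group in concrete form\<close>

lemma homeo_group_simps:
  "x \<otimes>\<^bsub>homeo_group\<^esub> y = x \<circ> y" "\<one>\<^bsub>homeo_group\<^esub> = id"
  by (simp_all add: homeo_group_def)

lemma homeo_group_iff:
  "h \<in> carrier homeo_group \<longleftrightarrow>
     bij h \<and> continuous_on UNIV h \<and> continuous_on UNIV (inv_into UNIV h)"
proof
  assume "h \<in> carrier homeo_group"
  then obtain k where k: "homeomorphism UNIV UNIV h k" by (auto simp: homeo_group_def)
  then have "h \<circ> k = id" "k \<circ> h = id" by (auto simp: homeomorphism_def)
  then have "bij h" "inv_into UNIV h = k" by (auto intro: o_bij inv_unique_comp)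
  with k show "bij h \<and> continuous_on UNIV h \<and> continuous_on UNIV (inv_into UNIV h)"
    by (auto simp: homeomorphism_def)
next
  assume *: "bij h \<and> continuous_on UNIV h \<and> continuous_on UNIV (inv_into UNIV h)"
  then have "homeomorphism UNIV UNIV h (inv_into UNIV h)"
    by (auto simp: homeomorphism_def bij_is_surj bij_is_inj bij_imp_bij_inv surj_f_inv_f)
  then show "h \<in> carrier homeo_group" by (auto simp: homeo_group_def)
qed

lemma homeo_group_inv:
  assumes "h \<in> carrier homeo_group"
  shows "inv\<^bsub>homeo_group\<^esub> h = inv_into UNIV h"
proof (rule group.inv_equality[OF group_homeo_group])
  have h: "bij h" "continuous_on UNIV h" "continuous_on UNIV (inv_into UNIV h)"
    using assms by (auto simp: homeo_group_iff)
  then show "inv_into UNIV h \<in> carrier homeo_group"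
    by (simp add: homeo_group_iff bij_imp_bij_inv inv_inv_eq)
  show "inv_into UNIV h \<otimes>\<^bsub>homeo_group\<^esub> h = \<one>\<^bsub>homeo_group\<^esub>"
    using h by (simp add: homeo_group_simps bij_is_inj)
qed (fact assms)

lemma homeo_open_image:
  assumes "h \<in> carrier homeo_group" "open U"
  shows "open (h ` U)"
proof -
  have "h ` U = inv_into UNIV h -` U"
    using assms by (simp add: homeo_group_iff bij_vimage_eq_inv_image bij_imp_bij_inv inv_inv_eq)
  then show ?thesis using assms by (auto simp: homeo_group_iff intro: open_vimage)
qed

section \<open>Maps locally in a group of homeomorphisms, and its full group\<close>

definition locally_in :: "('a::topological_space \<Rightarrow> 'a) set \<Rightarrow> ('a \<Rightarrow> 'a) \<Rightarrow> 'a \<Rightarrow> bool" where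
  "locally_in \<Gamma> f z \<longleftrightarrow> (\<exists>U g. open U \<and> z \<in> U \<and> g \<in> \<Gamma> \<and> (\<forall>w\<in>U. f w = g w))"

lemma locally_inI: "open U \<Longrightarrow> z \<in> U \<Longrightarrow> g \<in> \<Gamma> \<Longrightarrow> (\<And>w. w \<in> U \<Longrightarrow> f w = g w) \<Longrightarrow> locally_in \<Gamma> f z"
  by (auto simp: locally_in_def)

lemma locally_in_cong:
  assumes "open U" "z \<in> U" "\<And>w. w \<in> U \<Longrightarrow> f w = g w" "locally_in \<Gamma> g z"
  shows "locally_in \<Gamma> f z"
proof -
  from assms(4) obtain V c where "open V" "z \<in> V" "c \<in> \<Gamma>" "\<forall>w\<in>V. g w = c w"
    by (auto simp: locally_in_def)
  with assms show ?thesis by (intro locally_inI[of "U \<inter> V" z c]) auto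
qed

lemma continuous_on_UNIV_local:
  fixes f :: "'a::topological_space \<Rightarrow> 'b::topological_space"
  shows "continuous_on UNIV f \<longleftrightarrow>
    (\<forall>z V. open V \<longrightarrow> f z \<in> V \<longrightarrow> (\<exists>U. open U \<and> z \<in> U \<and> f ` U \<subseteq> V))"
  by (fastforce simp: continuous_on_topological)

locale homeo_subgroup =
  fixes \<Gamma> :: "('a::topological_space \<Rightarrow> 'a) set"
  assumes subgroup: "subgroup \<Gamma> homeo_group"
begin

lemma homeo: "g \<in> \<Gamma> \<Longrightarrow> g \<in> carrier homeo_group"
  using subgroup.subset[OF subgroup] by blast

lemma bij: "g \<in> \<Gamma> \<Longrightarrow> bij g"
  and cont: "g \<in> \<Gamma> \<Longrightarrow> continuous_on UNIV g"
  using homeo by (auto simp: homeo_group_iff)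

lemma comp_mem: "g \<in> \<Gamma> \<Longrightarrow> h \<in> \<Gamma> \<Longrightarrow> g \<circ> h \<in> \<Gamma>"
  using subgroup.m_closed[OF subgroup] by (simp add: homeo_group_simps)

lemma id_mem: "id \<in> \<Gamma>"
  using subgroup.one_closed[OF subgroup] by (simp add: homeo_group_simps)

lemma inv_mem: "g \<in> \<Gamma> \<Longrightarrow> inv_into UNIV g \<in> \<Gamma>"
  using subgroup.m_inv_closed[OF subgroup] homeo_group_inv homeo by metis

lemma locally_in_id: "locally_in \<Gamma> id z"
  using id_mem by (intro locally_inI[of UNIV z id]) simp_all

lemma locally_in_comp:
  assumes "locally_in \<Gamma> f z" "locally_in \<Gamma> h (f z)"
  shows "locally_in \<Gamma> (h \<circ> f) z"
proof -
  obtain U a where U: "open U" "z \<in> U" "a \<in> \<Gamma>" "\<forall>w\<in>U. f w = a w"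
    using assms(1) by (auto simp: locally_in_def)
  obtain V b where V: "open V" "f z \<in> V" "b \<in> \<Gamma>" "\<forall>w\<in>V. h w = b w"
    using assms(2) by (auto simp: locally_in_def)
  show ?thesis
  proof (rule locally_inI)
    show "open (U \<inter> a -` V)" using U V cont by (intro open_Int open_vimage) auto
    show "b \<circ> a \<in> \<Gamma>" using U V comp_mem by blast
  qed (use U V in auto)
qed

text \<open>Near \<open>z\<close> the map coincides with a homeomorphism \<open>a\<close>, which
  sends \<open>U\<close> onto an open neighbourhood of \<open>f z\<close>; there injectivity of
  \<open>f\<close> forces its inverse to be that of \<open>a\<close>.\<close>

lemma locally_in_inv:
  assumes "inj f" "locally_in \<Gamma> f z"
  shows "locally_in \<Gamma> (inv_into UNIV f) (f z)"
proof -
  obtain U a where U: "open U" "z \<in> U" "a \<in> \<Gamma>" "\<forall>w\<in>U. f w = a w"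
    using assms(2) by (auto simp: locally_in_def)
  show ?thesis
  proof (rule locally_inI)
    show "open (a ` U)" using U homeo homeo_open_image by blast
    show "f z \<in> a ` U" using U by auto
    show "inv_into UNIV a \<in> \<Gamma>" using U inv_mem by blast
    fix w assume "w \<in> a ` U"
    then obtain u where "u \<in> U" "w = a u" by blast
    then show "inv_into UNIV f w = inv_into UNIV a w"
      using U assms(1) bij[of a] by (metis bij_is_inj inv_f_f)
  qed
qed

lemma locally_in_cont:
  assumes "locally_in \<Gamma> f z" "open V" "f z \<in> V"
  shows "\<exists>U. open U \<and> z \<in> U \<and> f ` U \<subseteq> V"
proof -
  obtain U a where U: "open U" "z \<in> U" "a \<in> \<Gamma>" "\<forall>w\<in>U. f w = a w"
    using assms(1) by (auto simp: locally_in_def)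
  then have "open (U \<inter> a -` V)" using assms cont by (auto intro: open_vimage)
  with U assms show ?thesis by (intro exI[of _ "U \<inter> a -` V"]) auto
qed

text \<open>Continuity of the map and of its inverse follows from local agreement, so membership is
  bijectivity plus a local check; \<open>full_eq\<close> recovers the description by
  homeomorphisms.\<close>

definition full :: "('a \<Rightarrow> 'a) set" where
  "full = {f. bij f \<and> (\<forall>z. locally_in \<Gamma> f z)}"

lemma full_cont: "f \<in> full \<Longrightarrow> continuous_on UNIV f"
  by (auto simp: full_def continuous_on_UNIV_local intro: locally_in_cont)

lemma full_id: "id \<in> full"
  by (auto simp: full_def intro: locally_in_id)

lemma full_comp: "f \<in> full \<Longrightarrow> g \<in> full \<Longrightarrow> g \<circ> f \<in> full"
  by (auto simp: full_def bij_comp intro: locally_in_comp)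

lemma full_inv:
  assumes "f \<in> full"
  shows "inv_into UNIV f \<in> full"
proof -
  have f: "bij f" "\<And>z. locally_in \<Gamma> f z" using assms by (auto simp: full_def)
  have "locally_in \<Gamma> (inv_into UNIV f) w" for w
    using locally_in_inv[OF bij_is_inj[OF f(1)] f(2), of "inv_into UNIV f w"] f(1)
    by (simp add: bij_is_surj surj_f_inv_f)
  then show ?thesis using f by (auto simp: full_def bij_imp_bij_inv)
qed

lemma full_eq: "full = {h \<in> carrier homeo_group. \<forall>z. locally_in \<Gamma> h z}"
  using full_cont full_inv by (fastforce simp: full_def homeo_group_iff)

lemma full_homeo: "f \<in> full \<Longrightarrow> f \<in> carrier homeo_group"
  by (simp add: full_eq)

text \<open>By disjointness, \<open>s\<close> exchanges \<open>W\<close> with its image under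
  \<open>g\<close> and is an involution, hence bijective. Both sets are clopen, so the three cases
  of \<open>s\<close> live on open sets.\<close>

lemma swap_full:
  assumes "open W" "closed W" "g \<in> \<Gamma>" "W \<inter> g ` W = {}"
  defines "s \<equiv> \<lambda>z. if z \<in> W then g z else if z \<in> g ` W then inv_into UNIV g z else z"
  shows "s \<in> full"
proof -
  have g: "inj g" "bij g" using assms bij bij_is_inj by auto
  have gi: "inv_into UNIV g (g z) = z" for z using g by simp
  have "s (s z) = z" for z using assms(4) by (auto simp: s_def gi)
  then have "bij s" by (metis bijI' )
  have oW: "open (g ` W)" using assms homeo homeo_open_image by blast
  have "- (g ` W) = g ` (- W)" using g by (simp add: bij_image_Compl_eq)
  then have oN: "open (- W \<inter> - (g ` W))"
    using assms homeo homeo_open_image[of g "- W"] by (auto intro: open_Int)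
  have "locally_in \<Gamma> s z" for z
  proof -
    consider "z \<in> W" | "z \<in> g ` W" | "z \<in> - W \<inter> - (g ` W)" by blast
    then show ?thesis
    proof cases
      case 1 then show ?thesis using assms by (intro locally_inI[of W z g]) auto
    next
      case 2 then show ?thesis using assms oW inv_mem
        by (intro locally_inI[of "g ` W" z "inv_into UNIV g"]) auto
    next
      case 3 then show ?thesis using oN id_mem
        by (intro locally_inI[of "- W \<inter> - (g ` W)" z id]) (auto simp: s_def)
    qed
  qed
  with \<open>bij s\<close> show ?thesis by (auto simp: full_def)
qed

end

section \<open>Minimal commutative actions on the Cantor space\<close>

locale minimal_cantor_action = homeo_subgroup \<Gamma> for \<Gamma> :: "('a::topological_space \<Rightarrow> 'a) set" +
  assumes cantor: "cantor_space TYPE('a)"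
    and commute: "g \<in> \<Gamma> \<Longrightarrow> h \<in> \<Gamma> \<Longrightarrow> g (h z) = h (g z)"
    and minimal: "minimal_action \<Gamma>"
begin

lemma orbit_meets:
  assumes "open U" "U \<noteq> {}"
  obtains g where "g \<in> \<Gamma>" "g z \<in> U"
proof -
  have "closure {h z |h. h \<in> \<Gamma>} = UNIV" using minimal by (simp add: minimal_action_def)
  then have "U \<inter> {h z |h. h \<in> \<Gamma>} \<noteq> {}"
    using open_Int_closure_eq_empty[OF assms(1), of "{h z |h. h \<in> \<Gamma>}"] assms(2) by simp
  then show thesis using that by blast
qed

lemma clopen_nbhd:
  assumes "open U" "(z :: 'a) \<in> U"
  obtains W where "open W" "closed W" "z \<in> W" "W \<subseteq> U"
proof -
  obtain P :: "nat \<Rightarrow> 'a set"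
    where P: "\<forall>n. open (P n) \<and> closed (P n) \<and> z \<in> P n \<and> (\<exists>y\<in>P n. y \<noteq> z)"
    "\<forall>U. open U \<longrightarrow> z \<in> U \<longrightarrow> (\<exists>n. P n \<subseteq> U)" "\<forall>y. y \<noteq> z \<longrightarrow> (\<exists>n. y \<notin> P n)"
    by (rule cantor_clopen_basis[OF cantor, of z])
  then obtain n where "P n \<subseteq> U" using assms by blast
  with P(1) show thesis using that[of "P n"] by blast
qed

lemma clopen_separate:
  assumes "y \<noteq> (z::'a)"
  obtains W where "open W" "closed W" "z \<in> W" "y \<notin> W"
proof -
  obtain P :: "nat \<Rightarrow> 'a set"
    where P: "\<forall>n. open (P n) \<and> closed (P n) \<and> z \<in> P n \<and> (\<exists>y\<in>P n. y \<noteq> z)"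
    "\<forall>U. open U \<longrightarrow> z \<in> U \<longrightarrow> (\<exists>n. P n \<subseteq> U)" "\<forall>y. y \<noteq> z \<longrightarrow> (\<exists>n. y \<notin> P n)"
    by (rule cantor_clopen_basis[OF cantor, of z])
  then obtain n where "y \<notin> P n" using assms by blast
  with P(1) show thesis using that[of "P n"] by blast
qed

text \<open>Points are closed: every other point has a clopen neighbourhood avoiding
  \<open>q\<close>.\<close>

lemma open_remove_point:
  fixes U :: "'a set"
  assumes "open U"
  shows "open (U - {q})"
proof (subst open_subopen, intro ballI)
  fix z assume z: "z \<in> U - {q}"
  then have "q \<noteq> z" by auto
  then obtain W where "open W" "closed W" "z \<in> W" "q \<notin> W" by (rule clopen_separate)
  with z assms show "\<exists>T. open T \<and> z \<in> T \<and> T \<subseteq> U - {q}" by (intro exI[of _ "U \<inter> W"]) auto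
qed

text \<open>No point is isolated, since each basic clopen neighbourhood of \<open>q\<close> contains
  a second point.\<close>

lemma open_remove_point_nonempty:
  fixes U :: "'a set"
  assumes "open U" "U \<noteq> {}"
  shows "U - {q} \<noteq> {}"
proof
  assume "U - {q} = {}"
  then have q: "q \<in> U" "U \<subseteq> {q}" using assms by auto
  obtain P :: "nat \<Rightarrow> 'a set"
    where P: "\<forall>n. open (P n) \<and> closed (P n) \<and> q \<in> P n \<and> (\<exists>y\<in>P n. y \<noteq> q)"
    "\<forall>U. open U \<longrightarrow> q \<in> U \<longrightarrow> (\<exists>n. P n \<subseteq> U)" "\<forall>y. y \<noteq> q \<longrightarrow> (\<exists>n. y \<notin> P n)"
    by (rule cantor_clopen_basis[OF cantor, of q])
  obtain n where "P n \<subseteq> U" using P(2) assms(1) q(1) by blast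
  moreover obtain y where "y \<in> P n" "y \<noteq> q" using P(1) by blast
  ultimately show False using q(2) by blast
qed

text \<open>By commutativity \<open>g\<close> fixes the whole orbit of \<open>x\<close>, which is dense.\<close>

lemma free:
  assumes "g \<in> \<Gamma>" "g x = x"
  shows "g = id"
proof (rule ccontr)
  assume "g \<noteq> id"
  then obtain z where "g z \<noteq> z" by (auto simp: fun_eq_iff)
  then obtain W where W: "open W" "closed W" "z \<in> W" "g z \<notin> W" by (rule clopen_separate)
  then have "open (W \<inter> g -` (- W))" "W \<inter> g -` (- W) \<noteq> {}"
    using assms cont by (auto intro!: open_Int open_vimage)
  then obtain h where h: "h \<in> \<Gamma>" "h x \<in> W \<inter> g -` (- W)" by (rule orbit_meets)
  then have "g (h x) = h x" using commute[OF assms(1) h(1), of x] assms(2) by simp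
  with h(2) show False by auto
qed

section \<open>Moving points within small open sets\<close>

text \<open>If \<open>p\<close> is not yet in \<open>V\<close>, a small clopen neighbourhood of
  \<open>p\<close> is swapped with a translate inside \<open>V\<close>. Keeping \<open>q\<close>
  fixed lets two such involutions be combined without one spoiling the effect of the other.\<close>

lemma move_point:
  assumes "open U" "p \<in> U" "open V" "V \<subseteq> U" "V \<noteq> {}" "p \<noteq> q"
  obtains s where "s \<in> full" "s \<circ> s = id" "s p \<in> V" "s q = q" "\<And>z. z \<notin> U \<Longrightarrow> s z = z"
proof (cases "p \<in> V")
  case True
  then show thesis using that[of id] full_id by simp
next
  case False
  obtain g where g: "g \<in> \<Gamma>" "g p \<in> V - {q}"
    using orbit_meets[OF open_remove_point[OF assms(3)] open_remove_point_nonempty[OF assms(3,5)]] .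
  have gb: "inj g" using g bij bij_is_inj by blast
  have "g p \<noteq> p" using g False by auto
  then obtain D where D: "open D" "closed D" "p \<in> D" "g p \<notin> D" by (rule clopen_separate)
  \<comment> \<open>Subsets of \<open>O'\<close> avoid \<open>q\<close>, are carried by
    \<open>g\<close> into \<open>V - {q}\<close>, and are disjoint from their image, because
    \<open>D\<close> contains the former and misses the latter.\<close>
  define O' where "O' = (U - {q}) \<inter> D \<inter> g -` (V - {q}) \<inter> g -` (- D)"
  have "open O'" unfolding O'_def
    using D assms g cont open_remove_point by (intro open_Int open_vimage) auto
  moreover have "p \<in> O'" using D g assms by (auto simp: O'_def)
  ultimately obtain W where W: "open W" "closed W" "p \<in> W" "W \<subseteq> O'" by (rule clopen_nbhd)
  have disj: "W \<inter> g ` W = {}" using W(4) by (auto simp: O'_def)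
  define s where "s = (\<lambda>z. if z \<in> W then g z else if z \<in> g ` W then inv_into UNIV g z else z)"
  show thesis
  proof (rule that)
    show "s \<in> full" using swap_full[OF W(1,2) g(1) disj] by (simp add: s_def)
    show "s \<circ> s = id" using disj gb by (auto simp: s_def fun_eq_iff)
    show "s p \<in> V" using W g by (simp add: s_def)
    show "s q = q" using W(4) by (auto simp: s_def O'_def)
    show "s z = z" if "z \<notin> U" for z using W(4) assms(4) that by (auto simp: s_def O'_def)
  qed
qed

text \<open>With \<open>y = g x'\<close>, precompose \<open>g\<close> with some \<open>s\<close>
  supported in \<open>U\<close> that takes \<open>x\<close> into \<open>Q'\<close>, so that
  \<open>g (s x)\<close> lies in \<open>Q\<close>, and takes some \<open>u\<close> in
  \<open>P'\<close> to \<open>x'\<close>, so that \<open>y\<close> stays in the image of the smaller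
  neighbourhood.\<close>

lemma refine_step:
  assumes g: "g \<in> full" and U: "open U" "x \<in> U" "y \<in> g ` U"
    and P: "open P" "x \<in> P" and Q: "open Q" "y \<in> Q"
  obtains g' U' where "g' \<in> full" "open U'" "x \<in> U'" "y \<in> g' ` U'" "U' \<subseteq> U" "U' \<subseteq> P"
    "g' ` U' \<subseteq> Q" "\<And>z. z \<notin> U \<Longrightarrow> g' z = g z"
proof -
  obtain x' where x': "x' \<in> U" "y = g x'" using U by blast
  define P' where "P' = U \<inter> P"
  define Q' where "Q' = U \<inter> g -` Q"
  have P': "open P'" "P' \<subseteq> U" "x \<in> P'" using U P by (auto simp: P'_def)
  have Q': "open Q'" "Q' \<subseteq> U" "x' \<in> Q'"
    using U Q x' full_cont[OF g] by (auto simp: Q'_def intro: open_vimage)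
  obtain s u where s: "s \<in> full" "s u = x'" "u \<in> P'" "s x \<in> Q'" "\<And>z. z \<notin> U \<Longrightarrow> s z = z"
  proof (cases "x = x'")
    case True
    then show thesis using that[of id x] full_id P' Q' by simp
  next
    case False
    \<comment> \<open>\<open>a\<close> brings \<open>x'\<close> near \<open>x\<close> while fixing
      \<open>x\<close>, and \<open>b\<close> brings \<open>x\<close> near \<open>x'\<close> while
      fixing \<open>x'\<close>; hence \<open>b \<circ> a\<close> sends \<open>u = a x'\<close> to
      \<open>x'\<close> and \<open>x\<close> to \<open>b x\<close>.\<close>
    obtain a where a: "a \<in> full" "a \<circ> a = id" "a x' \<in> P'" "a x = x" "\<And>z. z \<notin> U \<Longrightarrow> a z = z"
      by (rule move_point[OF U(1) x'(1) P'(1,2), of x]) (use P' False in auto)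
    obtain b where b: "b \<in> full" "b \<circ> b = id" "b x \<in> Q'" "b x' = x'" "\<And>z. z \<notin> U \<Longrightarrow> b z = z"
      by (rule move_point[OF U(1) U(2) Q'(1,2), of x']) (use Q' False in auto)
    show thesis
    proof (rule that)
      show "b \<circ> a \<in> full" using a b full_comp by blast
      have "a (a x') = x'" using a(2) by (simp add: fun_eq_iff)
      then show "(b \<circ> a) (a x') = x'" using b by simp
    qed (use a b in auto)
  qed
  show thesis
  proof (rule that)
    show F: "g \<circ> s \<in> full" using s g full_comp by blast
    show "open (P' \<inter> (g \<circ> s) -` Q)" using P' Q full_cont[OF F]
      by (intro open_Int open_vimage)
    have "u \<in> P' \<inter> (g \<circ> s) -` Q" "(g \<circ> s) u = y" using s x' Q by auto
    then show "y \<in> (g \<circ> s) ` (P' \<inter> (g \<circ> s) -` Q)" by blast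
  qed (use s P' in \<open>auto simp: P'_def Q'_def\<close>)
qed

section \<open>The conjugating homeomorphism as a limit\<close>

text \<open>This serves both the conjugator, exceptional at \<open>x\<close>, and its inverse,
  exceptional at \<open>y\<close>. Local agreement gives continuity elsewhere; at the exceptional
  point, neighbourhoods with shrinking images do.\<close>

lemma limit_cont:
  assumes loc: "\<And>z. z \<noteq> x \<Longrightarrow> locally_in \<Gamma> f z"
    and U: "\<And>n. open (U n)" "\<And>n. x \<in> U n"
    and Q: "\<And>V. open V \<Longrightarrow> f x \<in> V \<Longrightarrow> \<exists>n. f ` U n \<subseteq> V"
  shows "continuous_on UNIV f"
  unfolding continuous_on_UNIV_local
proof (intro allI impI)
  fix z V assume V: "open V" "f z \<in> V"
  show "\<exists>U. open U \<and> z \<in> U \<and> f ` U \<subseteq> V"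
  proof (cases "z = x")
    case True
    then show ?thesis using Q[of V] V U by blast
  next
    case False
    then show ?thesis using locally_in_cont loc V by blast
  qed
qed

lemma transport:
  obtains f where "f \<in> carrier homeo_group" "f x = y" "\<And>z. z \<noteq> x \<Longrightarrow> locally_in \<Gamma> f z"
proof -
  obtain P :: "nat \<Rightarrow> 'a set"
    where P: "\<forall>n. open (P n) \<and> closed (P n) \<and> x \<in> P n \<and> (\<exists>z\<in>P n. z \<noteq> x)"
    "\<forall>U. open U \<longrightarrow> x \<in> U \<longrightarrow> (\<exists>n. P n \<subseteq> U)" "\<forall>z. z \<noteq> x \<longrightarrow> (\<exists>n. z \<notin> P n)"
    by (rule cantor_clopen_basis[OF cantor, of x])
  obtain Q :: "nat \<Rightarrow> 'a set"
    where Q: "\<forall>n. open (Q n) \<and> closed (Q n) \<and> y \<in> Q n \<and> (\<exists>z\<in>Q n. z \<noteq> y)"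
    "\<forall>U. open U \<longrightarrow> y \<in> U \<longrightarrow> (\<exists>n. Q n \<subseteq> U)" "\<forall>z. z \<noteq> y \<longrightarrow> (\<exists>n. z \<notin> Q n)"
    by (rule cantor_clopen_basis[OF cantor, of y])
  \<comment> \<open>A stage is a map with a neighbourhood of \<open>x\<close>. \<open>P n\<close>
    makes the neighbourhoods shrink to \<open>x\<close>, \<open>Q n\<close> their images to
    \<open>y\<close>, and \<open>next_step\<close> freezes the map outside the current
    neighbourhood.\<close>
  define good where "good n t \<longleftrightarrow> fst t \<in> full \<and> open (snd t) \<and> x \<in> snd t \<and> y \<in> fst t ` snd t
      \<and> snd t \<subseteq> P n \<and> fst t ` snd t \<subseteq> Q n" for n and t :: "('a \<Rightarrow> 'a) \<times> 'a set"
  define next_step where "next_step t t' \<longleftrightarrow> snd t' \<subseteq> snd t \<and> (\<forall>z. z \<notin> snd t \<longrightarrow> fst t' z = fst t z)"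
    for t t' :: "('a \<Rightarrow> 'a) \<times> 'a set"
  have "\<exists>t. \<forall>n. good n (t n) \<and> next_step (t n) (t (Suc n))"
  proof (rule dependent_nat_choice)
    \<comment> \<open>The identity with the whole space is refined once, so that the first stage
      already obeys the bounds \<open>P 0\<close> and \<open>Q 0\<close>.\<close>
    show "\<exists>t. good 0 t"
      using refine_step[OF full_id open_UNIV, of x y "P 0" "Q 0"] P(1) Q(1)
      unfolding good_def by (metis UNIV_I fst_conv snd_conv surj_id)
  next
    fix t n assume "good n t"
    then show "\<exists>t'. good (Suc n) t' \<and> next_step t t'"
      using refine_step[of "fst t" "snd t" x y "P (Suc n)" "Q (Suc n)"] P(1) Q(1)
      unfolding good_def next_step_def by (metis fst_conv snd_conv)
  qed
  then obtain t where t: "\<And>n. good n (t n)" "\<And>n. next_step (t n) (t (Suc n))" by blast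
  define g where "g n = fst (t n)" for n
  define U where "U n = snd (t n)" for n
  have g: "g n \<in> full" "bij (g n)" for n using t(1)[of n] by (auto simp: good_def g_def full_def)
  have U: "open (U n)" "x \<in> U n" "y \<in> g n ` U n" "U n \<subseteq> P n" "g n ` U n \<subseteq> Q n" for n
    using t(1)[of n] by (auto simp: good_def g_def U_def)
  have next_sub: "U (Suc n) \<subseteq> U n" and next_eq: "z \<notin> U n \<Longrightarrow> g (Suc n) z = g n z" for n z
    using t(2)[of n] by (auto simp: next_step_def g_def U_def)
  have dec: "U m \<subseteq> U n" if "n \<le> m" for m n
    using next_sub that by (rule lift_Suc_antimono_le)
  have stable: "g m z = g n z" if "n \<le> m" "z \<notin> U n" for m n z
    using that(1)
  proof (induction m rule: dec_induct)
    case (step m)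
    have "z \<notin> U m" using dec[OF step.hyps(1)] that(2) by blast
    then show ?case using next_eq step.IH by simp
  qed simp
  \<comment> \<open>Two bijections agreeing off \<open>U n\<close> have the same image of the
    complement, hence of \<open>U n\<close>.\<close>
  have image: "g m ` U n = g n ` U n" if "n \<le> m" for m n
  proof -
    have "g m ` (- U n) = g n ` (- U n)" using stable[OF that] by (intro image_cong) auto
    then have "- (g m ` U n) = - (g n ` U n)" using g by (simp add: bij_image_Compl_eq)
    then show ?thesis by simp
  qed
  \<comment> \<open>For \<open>z \<noteq> x\<close> the values \<open>g n z\<close> stop changing
    once \<open>z\<close> has left \<open>U n\<close>, and \<open>LEAST\<close> picks the first such
    stage. The point \<open>x\<close> never leaves, so its value is prescribed.\<close>
  define f where "f z = (if z = x then y else g (LEAST n. z \<notin> U n) z)" for z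
  have fx: "f x = y" by (simp add: f_def)
  have leaves: "\<exists>n. z \<notin> U n" if "z \<noteq> x" for z using P(3) that U(4) by blast
  have f: "f z = g n z" if "z \<notin> U n" for z n
  proof -
    have "z \<noteq> x" using that U(2) by auto
    moreover have "z \<notin> U (LEAST n. z \<notin> U n)" using that by (rule LeastI)
    moreover have "(LEAST n. z \<notin> U n) \<le> n" using that by (rule Least_le)
    ultimately show ?thesis using stable by (simp add: f_def)
  qed
  \<comment> \<open>Inside \<open>U n\<close> the map \<open>f\<close> may differ from
    \<open>g n\<close>, but later stages only rearrange values within the common image of
    \<open>U n\<close>. So membership in \<open>U n\<close> can be read off from the value of
    \<open>f\<close>.\<close>
  have fU: "f z \<in> g n ` U n \<longleftrightarrow> z \<in> U n" for z n
  proof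
    assume "z \<in> U n"
    show "f z \<in> g n ` U n"
    proof (cases "z = x")
      case True then show ?thesis using U fx by simp
    next
      case False
      then obtain m where m: "z \<notin> U m" using leaves by blast
      then have "n \<le> m" using \<open>z \<in> U n\<close> dec by (metis in_mono nle_le)
      then show ?thesis using f[OF m] image[of n m] \<open>z \<in> U n\<close> by blast
    qed
  next
    assume "f z \<in> g n ` U n"
    then show "z \<in> U n" using f[of z n] g(2)[of n] by (metis bij_is_inj inj_image_mem_iff)
  qed
  have "inj f"
  proof (rule injI)
    fix z w assume eq: "f z = f w"
    show "z = w"
    proof (cases "\<exists>n. z \<notin> U n")
      case True
      then obtain n where "z \<notin> U n" by blast
      moreover from this have "w \<notin> U n" using fU[of z n] fU[of w n] eq by simp
      ultimately show ?thesis using f eq g(2)[of n] by (metis bij_is_inj injD)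
    next
      case False
      then have "\<forall>n. w \<in> U n" using fU eq by metis
      with False have "w = x" "z = x" using leaves by blast+
      then show ?thesis by simp
    qed
  qed
  moreover have "surj f"
  proof -
    have "\<exists>z. f z = w" for w
    proof (cases "w = y")
      case True then show ?thesis using fx by blast
    next
      case False
      \<comment> \<open>The images of the \<open>U n\<close> shrink to \<open>y\<close>, so
        \<open>w\<close> is outside one of them; its preimage under \<open>g n\<close> is then off
        \<open>U n\<close>, where \<open>f\<close> agrees with \<open>g n\<close>.\<close>
      then obtain n where n: "w \<notin> g n ` U n" using Q(3) U(5) by blast
      obtain z where "w = g n z" using g(2)[of n] by (meson bij_pointE)
      with n f show ?thesis by blast
    qed
    then show ?thesis unfolding surj_def by metis
  qed
  ultimately have bf: "bij f" by (simp add: bij_def)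
  have loc: "locally_in \<Gamma> f z" if z: "z \<noteq> x" for z
  proof -
    \<comment> \<open>The complement of \<open>P n\<close>, not of \<open>U n\<close>, is the
      neighbourhood: \<open>P n\<close> is closed, while \<open>U n\<close> is only known to be
      open.\<close>
    obtain n where n: "z \<notin> P n" using P(3) z by blast
    show ?thesis
    proof (rule locally_in_cong)
      show "open (- P n)" "z \<in> - P n" using P n by auto
      show "f w = g n w" if "w \<in> - P n" for w using f U(4)[of n] that by blast
      show "locally_in \<Gamma> (g n) z" using g(1)[of n] by (auto simp: full_def)
    qed
  qed
  have inv_y: "inv_into UNIV f y = x" using fx \<open>inj f\<close> by (metis inv_f_f)
  have loc_inv: "locally_in \<Gamma> (inv_into UNIV f) w" if "w \<noteq> y" for w
    using locally_in_inv[OF \<open>inj f\<close> loc, of "inv_into UNIV f w"] that fx \<open>surj f\<close>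
    by (metis surj_f_inv_f)
  have inv_image: "inv_into UNIV f ` (g n ` U n) \<subseteq> U n" for n
    using fU \<open>surj f\<close> by (metis image_subsetI surj_f_inv_f)
  have "continuous_on UNIV f"
  proof (rule limit_cont[OF loc])
    show "open (U n)" "x \<in> U n" for n using U by auto
    fix V assume "open V" "f x \<in> V"
    then obtain n where "Q n \<subseteq> V" using Q fx by auto
    then show "\<exists>n. f ` U n \<subseteq> V" using fU U(5)[of n] by blast
  qed
  \<comment> \<open>With roles exchanged, the images of the \<open>U n\<close> are the
    neighbourhoods of \<open>y\<close>, and the inverse carries them into \<open>U n\<close>, hence
    into \<open>P n\<close>.\<close>
  moreover have "continuous_on UNIV (inv_into UNIV f)"
  proof (rule limit_cont[OF loc_inv])
    show "open (g n ` U n)" for n using U g full_homeo homeo_open_image by blast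
    show "y \<in> g n ` U n" for n using U by auto
    fix V assume "open V" "inv_into UNIV f y \<in> V"
    then obtain n where "P n \<subseteq> V" using P inv_y by auto
    then show "\<exists>n. inv_into UNIV f ` (g n ` U n) \<subseteq> V" using inv_image U(4)[of n] by blast
  qed
  ultimately have "f \<in> carrier homeo_group" using bf by (simp add: homeo_group_iff)
  then show thesis using that fx loc by blast
qed

section \<open>Conjugation of point stabilizers\<close>

text \<open>Near \<open>x\<close>, \<open>h\<close> agrees with an element of
  \<open>\<Gamma>\<close> fixing \<open>x\<close>, which is the identity by freeness; so the
  conjugate is the identity near \<open>y\<close>. At other points, \<open>h\<close> being injective
  and fixing \<open>x\<close> keeps the argument of \<open>f\<close> away from \<open>x\<close>, and
  the three local forms compose.\<close>

lemma conj_stabilizer: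
  assumes f: "f \<in> carrier homeo_group" "f x = y" and loc: "\<And>z. z \<noteq> x \<Longrightarrow> locally_in \<Gamma> f z"
    and h: "h \<in> St full x"
  shows "f \<circ> h \<circ> inv_into UNIV f \<in> St full y"
proof -
  let ?f' = "inv_into UNIV f"
  have bf: "bij f" "inj f" "surj f" using f by (auto simp: homeo_group_iff bij_def)
  have f'y: "?f' y = x" using f bf by (metis inv_f_f)
  have h': "h \<in> full" "bij h" "inj h" "h x = x" "\<And>z. locally_in \<Gamma> h z"
    using h by (auto simp: St_def full_def bij_is_inj)
  have "locally_in \<Gamma> (f \<circ> h \<circ> ?f') w" for w
  proof (cases "w = y")
    case True
    obtain U g where U: "open U" "x \<in> U" "g \<in> \<Gamma>" "\<forall>w\<in>U. h w = g w"
      using h'(5)[of x] by (auto simp: locally_in_def)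
    then have "g = id" using h'(4) free by metis
    show ?thesis
    proof (rule locally_inI)
      show "open (f ` U)" using U f homeo_open_image by blast
      show "w \<in> f ` U" using True U f by blast
      show "id \<in> \<Gamma>" by (rule id_mem)
    qed (use U \<open>g = id\<close> bf in auto)
  next
    case False
    then have ne: "?f' w \<noteq> x" using f bf by (metis surj_f_inv_f)
    then have "h (?f' w) \<noteq> x" using h' by (metis injD)
    moreover have "locally_in \<Gamma> ?f' w"
      using locally_in_inv[OF bf(2) loc[OF ne]] bf by (simp add: surj_f_inv_f)
    ultimately show ?thesis using loc h'(5) by (intro locally_in_comp) auto
  qed
  moreover have "bij (f \<circ> h \<circ> ?f')" using bf h' by (intro bij_comp bij_imp_bij_inv) auto
  ultimately show ?thesis using f'y h' f by (auto simp: St_def full_def)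
qed

text \<open>The inverse of \<open>f\<close> satisfies the same hypotheses with \<open>x\<close> and
  \<open>y\<close> exchanged, which gives the reverse inclusion.\<close>

lemma conj_stabilizer_eq:
  assumes f: "f \<in> carrier homeo_group" "f x = y" and loc: "\<And>z. z \<noteq> x \<Longrightarrow> locally_in \<Gamma> f z"
  shows "(\<lambda>h. f \<circ> h \<circ> inv_into UNIV f) ` St full x = St full y"
proof
  show "(\<lambda>h. f \<circ> h \<circ> inv_into UNIV f) ` St full x \<subseteq> St full y"
    using conj_stabilizer[OF assms] by blast
next
  let ?f' = "inv_into UNIV f"
  have bf: "bij f" "inj f" "surj f" using f by (auto simp: homeo_group_iff bij_def)
  have f': "?f' \<in> carrier homeo_group" "?f' y = x"
    using f bf by (auto simp: homeo_group_iff bij_imp_bij_inv inv_inv_eq)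
  have loc': "locally_in \<Gamma> ?f' w" if "w \<noteq> y" for w
    using locally_in_inv[OF bf(2) loc, of "?f' w"] that f bf by (metis surj_f_inv_f)
  show "St full y \<subseteq> (\<lambda>h. f \<circ> h \<circ> ?f') ` St full x"
  proof
    fix k assume "k \<in> St full y"
    then have "?f' \<circ> k \<circ> f \<in> St full x"
      using conj_stabilizer[OF f' loc', of k] bf by (simp add: inv_inv_eq)
    moreover have "k = f \<circ> (?f' \<circ> k \<circ> f) \<circ> ?f'" using bf by (simp add: fun_eq_iff surj_f_inv_f)
    ultimately show "k \<in> (\<lambda>h. f \<circ> h \<circ> ?f') ` St full x" by blast
  qed
qed

end

section \<open>Cyclic groups and the topological full group\<close>

text \<open>Both elements are integer powers of \<open>a\<close>, and their exponents add. This
  supplies the commutativity behind freeness.\<close>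

lemma generate_singleton_commute:
  assumes G: "group G" and a: "a \<in> carrier G"
    and g: "g \<in> generate G {a}" and h: "h \<in> generate G {a}"
  shows "g \<otimes>\<^bsub>G\<^esub> h = h \<otimes>\<^bsub>G\<^esub> g"
proof -
  interpret group G by fact
  obtain m n :: int where "g = a [^]\<^bsub>G\<^esub> m" "h = a [^]\<^bsub>G\<^esub> n"
    using g h generate_pow[OF a] by auto
  then show ?thesis using a by (simp add: int_pow_mult[symmetric] add.commute)
qed

theorem corollary3p2:
  fixes \<phi> :: "'a::topological_space \<Rightarrow> 'a"
  assumes "cantor_minimal_system \<phi>"
  shows "\<forall>x y. \<exists>f\<in>carrier homeo_group.
           f <#\<^bsub>homeo_group\<^esub> St (topological_full_group \<phi>) x #>\<^bsub>homeo_group\<^esub> inv\<^bsub>homeo_group\<^esub> f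
             = St (topological_full_group \<phi>) y"
proof (intro allI)
  fix x y :: 'a
  let ?\<Gamma> = "generate homeo_group {\<phi>}"
  have \<phi>: "\<phi> \<in> carrier homeo_group" using assms by (simp add: cantor_minimal_system_def)
  interpret minimal_cantor_action ?\<Gamma>
  proof (intro minimal_cantor_action.intro homeo_subgroup.intro minimal_cantor_action_axioms.intro)
    show "subgroup ?\<Gamma> homeo_group"
      using \<phi> by (intro group.generate_is_subgroup[OF group_homeo_group]) simp
    show "g (h z) = h (g z)" if "g \<in> ?\<Gamma>" "h \<in> ?\<Gamma>" for g h z
      using generate_singleton_commute[OF group_homeo_group \<phi> that]
      by (simp add: homeo_group_simps fun_eq_iff)
  qed (use assms in \<open>simp_all add: cantor_minimal_system_def\<close>)
  have full: "topological_full_group \<phi> = full"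
    by (simp add: topological_full_group_def full_eq locally_in_def)
  obtain f where f: "f \<in> carrier homeo_group" "f x = y" "\<And>z. z \<noteq> x \<Longrightarrow> locally_in ?\<Gamma> f z"
    by (rule transport[of x y]) blast
  have "f <#\<^bsub>homeo_group\<^esub> St full x #>\<^bsub>homeo_group\<^esub> inv\<^bsub>homeo_group\<^esub> f
      = (\<lambda>h. f \<circ> h \<circ> inv_into UNIV f) ` St full x"
    using f(1) by (auto simp: l_coset_def r_coset_def homeo_group_simps homeo_group_inv)
  also have "\<dots> = St full y" using f by (rule conj_stabilizer_eq)
  finally show "\<exists>f\<in>carrier homeo_group.
      f <#\<^bsub>homeo_group\<^esub> St (topological_full_group \<phi>) x #>\<^bsub>homeo_group\<^esub> inv\<^bsub>homeo_group\<^esub> f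
        = St (topological_full_group \<phi>) y"
    using f(1) unfolding full by blast
qed

end
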